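(* Let $\mathsf{h}_1,\mathsf{h}_2$ be Hessenberg functions on $[n]$ and let $\mathsf{U}_{\mathsf{h}_1},\mathsf{U}_{\mathsf{h}_2}$ be the associated unipotent subgroups of $\mathrm{G}=\mathrm{GL}_n(\mathbb{F}_q)$. Then \[ |\mathsf{U}_{\mathsf{h}_1}\backslash\mathrm{G}/\mathsf{U}_{\mathsf{h}_2}|=q^{|\mathsf{h}_1|+|\mathsf{h}_2|-2n^2}\sum_{\mu\vdash n}|\mathrm{Z}_{\mathrm{G}}(I+J_\mu)|\,\mathrm{F}_{\mu\mathsf{h}_1}(q)\,\mathrm{F}_{\mu\mathsf{h}_2}(q), \] where $\mathrm{Z}_{\mathrm{G}}(I+J_\mu)$ is the centralizer of $I+J_\mu$ in $\mathrm{G}$.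
   Context: A Hessenberg function is a non-decreasing $\mathsf{h}:[n]\to[n]$ with $\mathsf{h}(i)\ge i$; $|\mathsf{h}|=\sum_i\mathsf{h}(i)$. $\mathfrak{u}_\mathsf{h}(\mathbb{F}_q)$ is the set of $n\times n$ matrices $(a_{ij})$ over $\mathbb{F}_q$ with $a_{ij}=0$ whenever $j\le\mathsf{h}(i)$, and $\mathsf{U}_\mathsf{h}=\{I+A:A\in\mathfrak{u}_\mathsf{h}(\mathbb{F}_q)\}$. $J_\mu$ is the nilpotent Jordan matrix of type $\mu$, $\mathcal{C}_\mu$ its $\mathrm{GL}_n(\mathbb{F}_q)$-conjugacy class, $\mathrm{F}_{\mu\mathsf{h}}(q)=|\mathcal{C}_\mu\cap\mathfrak{u}_\mathsf{h}(\mathbb{F}_q)|$. *)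

theory Defs
  imports "Jordan_Normal_Form.Jordan_Normal_Form" "HOL-Algebra.Coset" "HOL-Library.Cardinality"
begin

(* The finite field F_q is a type 'a of sort {field, finite}, and q is CARD('a).
   Its matrices are those of Jordan_Normal_Form, whose indices start at 0. *)

definition GL :: "'a :: {field, finite} itself \<Rightarrow> nat \<Rightarrow> 'a mat monoid" where
  "GL ty n = units_of (ring_mat ty n ())"

(* Only the values of h on [n] = {1..n} matter, here and in hess_size and hess_nil. *)
definition hessenberg :: "nat \<Rightarrow> (nat \<Rightarrow> nat) \<Rightarrow> bool" where
  "hessenberg n h \<longleftrightarrow>
     h ` {1..n} \<subseteq> {1..n} \<and> mono_on {1..n} h \<and> (\<forall>i\<in>{1..n}. i \<le> h i)"

definition hess_size :: "nat \<Rightarrow> (nat \<Rightarrow> nat) \<Rightarrow> nat" where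
  "hess_size n h = (\<Sum>i=1..n. h i)"

(* The entry a_{ij} with 1-based i, j is A $$ (i - 1, j - 1). *)
definition hess_nil :: "nat \<Rightarrow> (nat \<Rightarrow> nat) \<Rightarrow> 'a :: {field, finite} mat set" where
  "hess_nil n h =
     {A \<in> carrier_mat n n. \<forall>i\<in>{1..n}. \<forall>j\<in>{1..n}. j \<le> h i \<longrightarrow> A $$ (i - 1, j - 1) = 0}"

definition hess_unip :: "nat \<Rightarrow> (nat \<Rightarrow> nat) \<Rightarrow> 'a :: {field, finite} mat set" where
  "hess_unip n h = {1\<^sub>m n + A | A. A \<in> hess_nil n h}"

(* A partition is the weakly decreasing list of its positive parts. *)
definition partitions_of :: "nat \<Rightarrow> nat list set" where
  "partitions_of n = {\<mu>. sorted_wrt (\<ge>) \<mu> \<and> (\<forall>m\<in>set \<mu>. 0 < m) \<and> sum_list \<mu> = n}"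

(* Library Jordan blocks carry their ones on the superdiagonal. *)
definition nilp_jordan :: "nat list \<Rightarrow> 'a :: {field, finite} mat" where
  "nilp_jordan \<mu> = jordan_matrix (map (\<lambda>m. (m, 0)) \<mu>)"

definition conj_class :: "nat \<Rightarrow> 'a :: {field, finite} mat \<Rightarrow> 'a mat set" where
  "conj_class n A = {g * A * inv\<^bsub>GL TYPE('a) n\<^esub> g | g. g \<in> carrier (GL TYPE('a) n)}"

definition hess_count ::
  "'a :: {field, finite} itself \<Rightarrow> nat \<Rightarrow> nat list \<Rightarrow> (nat \<Rightarrow> nat) \<Rightarrow> nat" where
  "hess_count ty n \<mu> h = card (conj_class n (nilp_jordan \<mu> :: 'a mat) \<inter> hess_nil n h)"

definition centralizer :: "('a, 'b) monoid_scheme \<Rightarrow> 'a \<Rightarrow> 'a set" where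
  "centralizer G x = {g \<in> carrier G. g \<otimes>\<^bsub>G\<^esub> x = x \<otimes>\<^bsub>G\<^esub> g}"

definition double_cosets :: "('a, 'b) monoid_scheme \<Rightarrow> 'a set \<Rightarrow> 'a set \<Rightarrow> 'a set set" where
  "double_cosets G H K = {(H #>\<^bsub>G\<^esub> g) <#>\<^bsub>G\<^esub> K | g. g \<in> carrier G}"

end

(* The double cosets are the orbits of U_{h1} x U_{h2} acting on G by (u, v) g = u g v^{-1}, so by
   Burnside's lemma the number of orbits times |U_{h1}| |U_{h2}| is the number of triples (u, v, g) with
   u g = g v. For a given pair (u, v) such g exist only if u and v are conjugate, and then they
   form a coset of the centralizer of u. Every element of U_{h1} is I + A with A strictly upper
   triangular, hence conjugate to I + J_mu for exactly one partition mu of n, and sorting the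
   pairs by mu gives the sum. Finally |U_h| = q^{n^2 - |h|}. *)

theory Submission
  imports Defs "HOL-Algebra.Group_Action" "Jordan_Normal_Form.Jordan_Normal_Form_Existence"
    "Jordan_Normal_Form.Jordan_Normal_Form_Uniqueness"
begin

section \<open>Double cosets and conjugacy in a finite group\<close>

definition (in group) conj_by :: "'a \<Rightarrow> 'a set" where
  "conj_by x = {g \<otimes> x \<otimes> inv g | g. g \<in> carrier G}"

lemma (in group) inv_mult_cancel:
  assumes "x \<in> carrier G" "y \<in> carrier G"
  shows "inv x \<otimes> (x \<otimes> y) = y" "x \<otimes> (inv x \<otimes> y) = y"
  using assms by (simp_all flip: m_assoc)

text \<open>Left multiplication by an element a of H is injective, hence a permutation of the finite
  set H. Solving a x = a puts the identity into H, and then a y = 1 gives the inverse. For unipotent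
  matrices this spares an explicit inversion of I + A.\<close>

lemma (in group) finite_subgroupI:
  assumes "finite H" "H \<subseteq> carrier G" "H \<noteq> {}"
    and mult: "\<And>a b. a \<in> H \<Longrightarrow> b \<in> H \<Longrightarrow> a \<otimes> b \<in> H"
  shows "subgroup H G"
proof (rule subgroupI)
  fix a assume a: "a \<in> H"
  have "inj_on ((\<otimes>) a) H"
    using a assms(2) by (intro inj_onI) (metis inv_mult_cancel(1) subsetD)
  moreover have "(\<otimes>) a ` H \<subseteq> H"
    using mult a by blast
  ultimately have surj: "(\<otimes>) a ` H = H"
    using assms(1) by (simp add: endo_inj_surj)
  have carr: "x \<in> carrier G" if "x \<in> H" for x
    using that assms(2) by blast
  obtain x where x: "x \<in> H" "a \<otimes> x = a"
    using a surj by (metis imageE)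
  then have "x = \<one>"
    using inv_mult_cancel(1)[OF carr[OF a] carr[OF x(1)]] l_inv[OF carr[OF a]] by simp
  then obtain y where y: "y \<in> H" "a \<otimes> y = \<one>"
    using x(1) surj by (metis imageE)
  then have "y = inv a"
    using inv_mult_cancel(1)[OF carr[OF a] carr[OF y(1)]] carr[OF a] by simp
  then show "inv a \<in> H"
    using y(1) by simp
qed (use assms in auto)

text \<open>Inverting k makes right multiplication a left action, since (k k')^{-1} = k'^{-1}
  k^{-1}. The maps are restricted to the carrier because \<open>BijGroup\<close> consists of
  extensional functions.\<close>

lemma (in group) double_coset_action:
  assumes H: "subgroup H G" and K: "subgroup K G"
  shows "group_action (G\<lparr>carrier := H\<rparr> \<times>\<times> G\<lparr>carrier := K\<rparr>) (carrier G)
           (\<lambda>(h, k). \<lambda>g\<in>carrier G. h \<otimes> g \<otimes> inv k)"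
    (is "group_action ?P _ ?\<phi>")
proof -
  have P: "group ?P"
    using H K by (simp add: DirProd_group subgroup.subgroup_is_group)
  have Hc: "\<And>h. h \<in> H \<Longrightarrow> h \<in> carrier G" and Kc: "\<And>k. k \<in> K \<Longrightarrow> k \<in> carrier G"
    using subgroup.subset[OF H] subgroup.subset[OF K] by auto
  have bij: "?\<phi> (h, k) \<in> Bij (carrier G)" if h: "h \<in> carrier G" and k: "k \<in> carrier G" for h k
  proof -
    have "bij_betw (\<lambda>g. h \<otimes> g \<otimes> inv k) (carrier G) (carrier G)"
      by (rule bij_betwI[where g = "\<lambda>g. inv h \<otimes> g \<otimes> k"])
        (use h k in \<open>auto simp: m_assoc inv_mult_cancel\<close>)
    then have "bij_betw (\<lambda>g\<in>carrier G. h \<otimes> g \<otimes> inv k) (carrier G) (carrier G)"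
      by (simp cong: bij_betw_cong)
    then show ?thesis
      by (simp add: Bij_def)
  qed
  have "?\<phi> \<in> hom ?P (BijGroup (carrier G))"
  proof (rule homI)
    fix x assume "x \<in> carrier ?P"
    then show "?\<phi> x \<in> carrier (BijGroup (carrier G))"
      using bij Hc Kc by (auto simp: BijGroup_def)
  next
    fix x y assume "x \<in> carrier ?P" "y \<in> carrier ?P"
    then obtain h k h' k' where xy: "x = (h, k)" "y = (h', k')"
      and mem: "h \<in> carrier G" "k \<in> carrier G" "h' \<in> carrier G" "k' \<in> carrier G"
      using Hc Kc by auto
    have "?\<phi> (x \<otimes>\<^bsub>?P\<^esub> y) = compose (carrier G) (?\<phi> x) (?\<phi> y)"
      unfolding xy using mem by (auto simp: compose_def inv_mult_group m_assoc fun_eq_iff)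
    then show "?\<phi> (x \<otimes>\<^bsub>?P\<^esub> y) = ?\<phi> x \<otimes>\<^bsub>BijGroup (carrier G)\<^esub> ?\<phi> y"
      using bij[OF mem(1,2)] bij[OF mem(3,4)] by (simp add: BijGroup_def xy)
  qed
  then show ?thesis
    using P by (simp add: group_action_def group_hom_def group_hom_axioms_def group_BijGroup)
qed

lemma (in group) orbits_eq_double_cosets:
  assumes H: "subgroup H G" and K: "subgroup K G"
  shows "orbits (G\<lparr>carrier := H\<rparr> \<times>\<times> G\<lparr>carrier := K\<rparr>) (carrier G)
           (\<lambda>(h, k). \<lambda>g\<in>carrier G. h \<otimes> g \<otimes> inv k) = double_cosets G H K"
    (is "orbits ?P _ ?\<phi> = _")
proof -
  have "orbit ?P ?\<phi> g = (H #> g) <#> K" if g: "g \<in> carrier G" for g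
  proof (intro equalityI subsetI)
    fix x assume "x \<in> orbit ?P ?\<phi> g"
    then obtain h k where "h \<in> H" "k \<in> K" "x = h \<otimes> g \<otimes> inv k"
      using g by (auto simp: orbit_def)
    then show "x \<in> (H #> g) <#> K"
      using subgroup.m_inv_closed[OF K] by (auto simp: set_mult_def r_coset_def)
  next
    fix x assume "x \<in> (H #> g) <#> K"
    then obtain h k where hk: "h \<in> H" "k \<in> K" "x = h \<otimes> g \<otimes> k"
      by (auto simp: set_mult_def r_coset_def)
    \<comment> \<open>Orbits involve \<open>inv k\<close> where double cosets involve k; closure of
      K under inverses reconciles the two.\<close>
    have "inv k \<in> K" "inv (inv k) = k"
      using hk subgroup.m_inv_closed[OF K] subgroup.mem_carrier[OF K] by auto
    then have "x = ?\<phi> (h, inv k) g" "(h, inv k) \<in> carrier ?P"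
      using hk g by auto
    then show "x \<in> orbit ?P ?\<phi> g"
      unfolding orbit_def by blast
  qed
  then show ?thesis
    by (auto simp: orbits_def double_cosets_def)
qed

text \<open>Burnside's lemma for the action above: (h, k) fixes g exactly when h g k^{-1} = g, that
  is, h g = g k.\<close>

lemma (in group) card_double_cosets:
  assumes fin: "finite (carrier G)" and H: "subgroup H G" and K: "subgroup K G"
  shows "card (double_cosets G H K) * (card H * card K) =
    (\<Sum>h\<in>H. \<Sum>k\<in>K. card {g \<in> carrier G. h \<otimes> g = g \<otimes> k})"
proof -
  define P where "P = G\<lparr>carrier := H\<rparr> \<times>\<times> G\<lparr>carrier := K\<rparr>"
  define \<phi> where "\<phi> = (\<lambda>(h, k). \<lambda>g\<in>carrier G. h \<otimes> g \<otimes> inv k)"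
  interpret A: group_action P "carrier G" \<phi>
    unfolding P_def \<phi>_def by (rule double_coset_action[OF H K])
  have carr: "carrier P = H \<times> K"
    by (simp add: P_def)
  have "finite H" "finite K"
    using fin subgroup.subset[OF H] subgroup.subset[OF K] by (auto intro: finite_subset)
  have inv: "invariants (carrier G) \<phi> (h, k) = {g \<in> carrier G. h \<otimes> g = g \<otimes> k}"
    if "h \<in> H" "k \<in> K" for h k
  proof -
    have "h \<in> carrier G" "k \<in> carrier G"
      using that subgroup.mem_carrier[OF H] subgroup.mem_carrier[OF K] by auto
    then have "h \<otimes> g \<otimes> inv k = g \<longleftrightarrow> h \<otimes> g = g \<otimes> k" if "g \<in> carrier G" for g
      using that by (metis inv_solve_right m_closed)
    then show ?thesis
      by (auto simp: invariants_def \<phi>_def)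
  qed
  have "card (double_cosets G H K) * (card H * card K) = card (orbits P (carrier G) \<phi>) * order P"
    unfolding P_def \<phi>_def orbits_eq_double_cosets[OF H K]
    by (simp add: order_def card_cartesian_product)
  also have "\<dots> = (\<Sum>x\<in>H \<times> K. card (invariants (carrier G) \<phi> x))"
    using A.burnside[OF _ fin] \<open>finite H\<close> \<open>finite K\<close> by (simp add: carr)
  also have "\<dots> = (\<Sum>h\<in>H. \<Sum>k\<in>K. card (invariants (carrier G) \<phi> (h, k)))"
    by (simp add: sum.cartesian_product)
  also have "\<dots> = (\<Sum>h\<in>H. \<Sum>k\<in>K. card {g \<in> carrier G. h \<otimes> g = g \<otimes> k})"
    by (intro sum.cong refl) (simp add: inv)
  finally show ?thesis .
qed

text \<open>With x = p r p^{-1} and y = s r s^{-1}, the map g -> p^{-1} g s carries the solutions of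
  x g = g y bijectively onto the centralizer of r.\<close>

lemma (in group) card_intertwiners:
  assumes r: "r \<in> carrier G" and x: "x \<in> conj_by r" and y: "y \<in> conj_by r"
  shows "card {g \<in> carrier G. x \<otimes> g = g \<otimes> y} = card (centralizer G r)"
proof -
  obtain p s where p: "p \<in> carrier G" "x = p \<otimes> r \<otimes> inv p"
    and s: "s \<in> carrier G" "y = s \<otimes> r \<otimes> inv s"
    using x y by (auto simp: conj_by_def)
  have iff: "p \<otimes> r \<otimes> inv p \<otimes> g = g \<otimes> (s \<otimes> r \<otimes> inv s) \<longleftrightarrow>
      inv p \<otimes> g \<otimes> s \<otimes> r = r \<otimes> (inv p \<otimes> g \<otimes> s)" if g: "g \<in> carrier G" for g
  proof -
    \<comment> \<open>The equation is multiplied by \<open>inv p\<close> on the left and by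
      \<open>s\<close> on the right, which loses nothing; the two sides are then simplified
      separately.\<close>
    have "p \<otimes> r \<otimes> inv p \<otimes> g = g \<otimes> (s \<otimes> r \<otimes> inv s) \<longleftrightarrow>
        inv p \<otimes> (p \<otimes> r \<otimes> inv p \<otimes> g) \<otimes> s = inv p \<otimes> (g \<otimes> (s \<otimes> r \<otimes> inv s)) \<otimes> s"
      using p s r g by simp
    also have "inv p \<otimes> (p \<otimes> r \<otimes> inv p \<otimes> g) \<otimes> s = r \<otimes> (inv p \<otimes> g \<otimes> s)"
      using p s r g by (simp add: m_assoc inv_mult_cancel)
    also have "inv p \<otimes> (g \<otimes> (s \<otimes> r \<otimes> inv s)) \<otimes> s = inv p \<otimes> g \<otimes> s \<otimes> r"
      using p s r g by (simp add: m_assoc)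
    finally show ?thesis by metis
  qed
  have "bij_betw (\<lambda>g. inv p \<otimes> g \<otimes> s) {g \<in> carrier G. x \<otimes> g = g \<otimes> y} (centralizer G r)"
  proof (rule bij_betwI[where g = "\<lambda>g. p \<otimes> g \<otimes> inv s"])
    show "(\<lambda>g. inv p \<otimes> g \<otimes> s) \<in> {g \<in> carrier G. x \<otimes> g = g \<otimes> y} \<rightarrow> centralizer G r"
      using p s r iff by (auto simp: centralizer_def)
    have *: "inv p \<otimes> (p \<otimes> g \<otimes> inv s) \<otimes> s = g" if "g \<in> carrier G" for g
      using that p s by (simp add: m_assoc inv_mult_cancel)
    show "(\<lambda>g. p \<otimes> g \<otimes> inv s) \<in> centralizer G r \<rightarrow> {g \<in> carrier G. x \<otimes> g = g \<otimes> y}"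
    proof
      fix g assume "g \<in> centralizer G r"
      then have g: "g \<in> carrier G" "g \<otimes> r = r \<otimes> g"
        by (auto simp: centralizer_def)
      then show "p \<otimes> g \<otimes> inv s \<in> {g \<in> carrier G. x \<otimes> g = g \<otimes> y}"
        using p s iff[of "p \<otimes> g \<otimes> inv s"] *[OF g(1)] by simp
    qed
  qed (use p s r in \<open>auto simp: centralizer_def m_assoc inv_mult_cancel\<close>)
  then show ?thesis
    by (rule bij_betw_same_card)
qed

lemma (in group) conj_by_closed:
  assumes r: "r \<in> carrier G" and g: "g \<in> carrier G" and x: "x \<in> conj_by r"
  shows "g \<otimes> x \<otimes> inv g \<in> conj_by r"
proof -
  obtain p where "p \<in> carrier G" "x = p \<otimes> r \<otimes> inv p"
    using x by (auto simp: conj_by_def)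
  then have "g \<otimes> x \<otimes> inv g = (g \<otimes> p) \<otimes> r \<otimes> inv (g \<otimes> p)" "g \<otimes> p \<in> carrier G"
    using g r by (auto simp: m_assoc inv_mult_group)
  then show ?thesis
    unfolding conj_by_def by blast
qed

text \<open>An intertwiner g gives y = g^{-1} x g. Hence a pair taken from different classes has no
  intertwiner.\<close>

lemma (in group) conj_by_trans_intertwine:
  assumes r: "r \<in> carrier G" and g: "g \<in> carrier G" and y: "y \<in> carrier G"
    and x: "x \<in> conj_by r" and eq: "x \<otimes> g = g \<otimes> y"
  shows "y \<in> conj_by r"
proof -
  have "x \<in> carrier G"
    using x r by (auto simp: conj_by_def)
  then have "y = inv g \<otimes> x \<otimes> inv (inv g)"
    using g y eq by (simp add: m_assoc inv_solve_left)
  then show ?thesis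
    using conj_by_closed[OF r _ x, of "inv g"] g by simp
qed

text \<open>Each h in H lies in exactly one class, that of some \<open>r i\<close>. A pair (h, k) is
  counted with the order of the centralizer of \<open>r i\<close> if k lies in the same class, and
  with 0 otherwise. Summing the product of the two indicators over H and K gives the product of the
  class counts.\<close>

theorem (in group) card_double_cosets_conj_classes:
  assumes fin: "finite (carrier G)" and H: "subgroup H G" and K: "subgroup K G"
    and I: "finite I" and r: "\<And>i. i \<in> I \<Longrightarrow> r i \<in> carrier G"
    and ex: "\<And>x. x \<in> H \<Longrightarrow> \<exists>i\<in>I. x \<in> conj_by (r i)"
    and uniq: "\<And>x i j. i \<in> I \<Longrightarrow> j \<in> I \<Longrightarrow> x \<in> conj_by (r i) \<Longrightarrow> x \<in> conj_by (r j) \<Longrightarrow> i = j"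
  shows "card (double_cosets G H K) * (card H * card K) =
    (\<Sum>i\<in>I. card (centralizer G (r i)) * card (conj_by (r i) \<inter> H) * card (conj_by (r i) \<inter> K))"
proof -
  have finHK: "finite H" "finite K"
    using fin subgroup.subset[OF H] subgroup.subset[OF K] by (auto intro: finite_subset)
  have "card {g \<in> carrier G. h \<otimes> g = g \<otimes> k} =
      (\<Sum>i\<in>I. card (centralizer G (r i)) * of_bool (h \<in> conj_by (r i)) * of_bool (k \<in> conj_by (r i)))"
    if h: "h \<in> H" and k: "k \<in> K" for h k
  proof -
    obtain i where i: "i \<in> I" "h \<in> conj_by (r i)"
      using ex[OF h] by blast
    \<comment> \<open>By \<open>uniq\<close>, the indicator of h vanishes at every index other than
      i.\<close>
    have "(\<Sum>j\<in>I. card (centralizer G (r j)) * of_bool (h \<in> conj_by (r j)) * of_bool (k \<in> conj_by (r j)))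
        = (\<Sum>j\<in>{i}. card (centralizer G (r j)) * of_bool (h \<in> conj_by (r j)) * of_bool (k \<in> conj_by (r j)))"
      using i uniq I by (intro sum.mono_neutral_right) auto
    also have "\<dots> = card {g \<in> carrier G. h \<otimes> g = g \<otimes> k}"
    proof (cases "k \<in> conj_by (r i)")
      case True
      then show ?thesis
        using card_intertwiners[OF r i(2)] i by simp
    next
      case False
      then have "{g \<in> carrier G. h \<otimes> g = g \<otimes> k} = {}"
        using conj_by_trans_intertwine[OF r _ subgroup.mem_carrier[OF K k] i(2)] i(1) by blast
      then show ?thesis
        using False by (simp only: card.empty) simp
    qed
    finally show ?thesis ..
  qed
  then have "card (double_cosets G H K) * (card H * card K) = (\<Sum>h\<in>H. \<Sum>k\<in>K. \<Sum>i\<in>I.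
      card (centralizer G (r i)) * of_bool (h \<in> conj_by (r i)) * of_bool (k \<in> conj_by (r i)))"
    unfolding card_double_cosets[OF fin H K] by (intro sum.cong refl) simp
  also have "\<dots> = (\<Sum>i\<in>I. \<Sum>h\<in>H. \<Sum>k\<in>K.
      card (centralizer G (r i)) * of_bool (h \<in> conj_by (r i)) * of_bool (k \<in> conj_by (r i)))"
    by (simp only: sum.swap[where A = K and B = I] sum.swap[where A = H and B = I])
  \<comment> \<open>The summand is a constant times a function of h times a function of k, so the
    double sum factors.\<close>
  also have "\<dots> = (\<Sum>i\<in>I. card (centralizer G (r i)) *
      (\<Sum>h\<in>H. of_bool (h \<in> conj_by (r i))) * (\<Sum>k\<in>K. of_bool (k \<in> conj_by (r i))))"
    by (simp only: mult.assoc sum_product) (simp only: sum_distrib_left)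
  also have "\<dots> = (\<Sum>i\<in>I. card (centralizer G (r i)) * card (conj_by (r i) \<inter> H) * card (conj_by (r i) \<inter> K))"
    using finHK by (simp add: Int_commute)
  finally show ?thesis .
qed

section \<open>Matrices with prescribed zeros and Hessenberg functions\<close>

text \<open>The entries at positions in S are free and all others are 0, so a matrix amounts to a
  function on S; taking it extensional makes the correspondence bijective.\<close>

lemma card_supported_mats:
  assumes S: "S \<subseteq> {..<n} \<times> {..<n}"
  shows "card {A \<in> carrier_mat n n. \<forall>i<n. \<forall>j<n. (i, j) \<notin> S \<longrightarrow> A $$ (i, j) = (0 :: 'a :: {field, finite})}
    = CARD('a) ^ card S" (is "card ?M = _")
proof -
  have fin: "finite S"
    using S by (rule finite_subset) auto
  have "bij_betw (\<lambda>A. \<lambda>ij\<in>S. A $$ ij) ?M (S \<rightarrow>\<^sub>E UNIV)"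
  proof (rule bij_betwI[where g = "\<lambda>f. mat n n (\<lambda>ij. if ij \<in> S then f ij else 0)"])
    show "(\<lambda>f. mat n n (\<lambda>ij. if ij \<in> S then f ij else 0)) \<in> (S \<rightarrow>\<^sub>E UNIV) \<rightarrow> ?M"
      by auto
  next
    fix f :: "nat \<times> nat \<Rightarrow> 'a" assume "f \<in> S \<rightarrow>\<^sub>E UNIV"
    then show "(\<lambda>ij\<in>S. mat n n (\<lambda>ij. if ij \<in> S then f ij else 0) $$ ij) = f"
      using S by (fastforce simp: fun_eq_iff PiE_def extensional_def)
  qed (auto intro!: eq_matI)
  then have "card ?M = card (S \<rightarrow>\<^sub>E (UNIV :: 'a set))"
    by (rule bij_betw_same_card)
  also have "\<dots> = CARD('a) ^ card S"
    using fin by (simp add: card_PiE)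
  finally show ?thesis .
qed

text \<open>Infinite sets have \<open>card\<close> 0, so the positive count obtained with all
  positions free proves finiteness.\<close>

lemma finite_carrier_mat: "finite (carrier_mat n n :: 'a :: {field, finite} mat set)"
proof (rule card_ge_0_finite)
  show "card (carrier_mat n n :: 'a mat set) > 0"
    using card_supported_mats[of "{..<n} \<times> {..<n}" n, where 'a = 'a] by simp
qed

text \<open>Passes from indices starting at 1 to those of the matrix type, starting at 0; hence
  \<open>Suc\<close> on both sides of the inequality.\<close>

lemma hess_nil_iff:
  "A \<in> hess_nil n h \<longleftrightarrow> A \<in> carrier_mat n n \<and>
     (\<forall>i<n. \<forall>j<n. Suc j \<le> h (Suc i) \<longrightarrow> A $$ (i, j) = 0)"
proof -
  have all: "(\<forall>i\<in>{1..n}. P i) \<longleftrightarrow> (\<forall>i<n. P (Suc i))" for P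
    using image_Suc_lessThan[of n] by (metis imageE imageI lessThan_iff)
  show ?thesis
    unfolding hess_nil_def all by simp
qed

lemma hessenbergD:
  assumes "hessenberg n h"
  shows "i < n \<Longrightarrow> h (Suc i) \<le> n" "i < n \<Longrightarrow> Suc i \<le> h (Suc i)"
    "i \<le> k \<Longrightarrow> k < n \<Longrightarrow> h (Suc i) \<le> h (Suc k)"
proof -
  have *: "Suc i \<in> {1..n}" if "i < n" for i using that by simp
  show "i < n \<Longrightarrow> h (Suc i) \<le> n" "i < n \<Longrightarrow> Suc i \<le> h (Suc i)"
    using assms * unfolding hessenberg_def by fastforce+
  show "i \<le> k \<Longrightarrow> k < n \<Longrightarrow> h (Suc i) \<le> h (Suc k)"
    using assms *[of i] *[of k] unfolding hessenberg_def mono_on_def by simp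
qed

lemma hess_size_Suc: "hess_size n h = (\<Sum>i<n. h (Suc i))"
  unfolding hess_size_def by (rule sum.reindex_bij_witness[of _ Suc "\<lambda>i. i - 1"]) auto

text \<open>Row i has n - h(i) free entries, which makes n^2 - |h| in all. The product form avoids
  subtraction in a natural exponent.\<close>

lemma card_hess_nil:
  assumes h: "hessenberg n h"
  shows "card (hess_nil n h :: 'a :: {field, finite} mat set) * CARD('a) ^ hess_size n h = CARD('a) ^ n\<^sup>2"
proof -
  define S where "S = Sigma {..<n} (\<lambda>i. {h (Suc i)..<n})"
  have "hess_nil n h = {A \<in> carrier_mat n n. \<forall>i<n. \<forall>j<n. (i, j) \<notin> S \<longrightarrow> A $$ (i, j) = (0 :: 'a)}"
    unfolding S_def by (auto simp: hess_nil_iff Suc_le_eq)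
  moreover have "S \<subseteq> {..<n} \<times> {..<n}"
    by (auto simp: S_def)
  ultimately have "card (hess_nil n h :: 'a mat set) = CARD('a) ^ card S"
    by (simp add: card_supported_mats)
  moreover have "card S + hess_size n h = n\<^sup>2"
  proof -
    have "card S + hess_size n h = (\<Sum>i<n. (n - h (Suc i)) + h (Suc i))"
      by (simp add: S_def hess_size_Suc sum.distrib)
    also have "\<dots> = (\<Sum>i<n. n)"
      using hessenbergD(1)[OF h] by (intro sum.cong) auto
    finally show ?thesis
      by (simp add: power2_eq_square)
  qed
  ultimately show ?thesis
    by (simp flip: power_add)
qed

text \<open>A nonzero A_{ik} needs k > h(i) >= i; monotonicity then gives h(k) >= h(i) >= j, so
  B_{kj} = 0.\<close>

lemma hess_nil_mult_closed:
  assumes h: "hessenberg n h" and A: "A \<in> hess_nil n h" and B: "B \<in> hess_nil n h"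
  shows "A * B \<in> hess_nil n h"
proof -
  have carr: "A \<in> carrier_mat n n" "B \<in> carrier_mat n n"
    using A B by (auto simp: hess_nil_iff)
  have "(A * B) $$ (i, j) = 0" if ij: "i < n" "j < n" "Suc j \<le> h (Suc i)" for i j
  proof -
    have "A $$ (i, k) * B $$ (k, j) = 0" if k: "k < n" for k
    proof (cases "Suc k \<le> h (Suc i)")
      case True
      then show ?thesis
        using A ij k by (simp add: hess_nil_iff)
    next
      case False
      then have "i \<le> k"
        using hessenbergD(2)[OF h ij(1)] by simp
      then have "Suc j \<le> h (Suc k)"
        using hessenbergD(3)[OF h _ k, of i] ij(3) by simp
      then show ?thesis
        using B ij k by (simp add: hess_nil_iff)
    qed
    then show ?thesis
      using carr ij by (auto simp: scalar_prod_def intro!: sum.neutral)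
  qed
  then show ?thesis
    using carr by (simp add: hess_nil_iff)
qed

lemma hess_nil_add_closed:
  "A \<in> hess_nil n h \<Longrightarrow> B \<in> hess_nil n h \<Longrightarrow> A + B \<in> hess_nil n h"
  by (auto simp: hess_nil_iff)

text \<open>Follows from (I + A)(I + B) = I + (B + (A + AB)) and closure of the nilpotent parts
  under sums and products.\<close>

lemma hess_unip_mult_closed:
  assumes h: "hessenberg n h" and "X \<in> hess_unip n h" "Y \<in> hess_unip n h"
  shows "X * Y \<in> hess_unip n h"
proof -
  obtain A B where AB: "A \<in> hess_nil n h" "B \<in> hess_nil n h" "X = 1\<^sub>m n + A" "Y = 1\<^sub>m n + B"
    using assms by (auto simp: hess_unip_def)
  then have carr: "A \<in> carrier_mat n n" "B \<in> carrier_mat n n"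
    by (auto simp: hess_nil_iff)
  have "X * Y = 1\<^sub>m n * (1\<^sub>m n + B) + A * (1\<^sub>m n + B)"
    unfolding AB(3,4) using carr by (intro add_mult_distrib_mat) auto
  also have "A * (1\<^sub>m n + B) = A * 1\<^sub>m n + A * B"
    by (rule mult_add_distrib_mat[OF carr(1) one_carrier_mat carr(2)])
  also have "1\<^sub>m n * (1\<^sub>m n + B) + (A * 1\<^sub>m n + A * B) = (1\<^sub>m n + B) + (A + A * B)"
    using carr by simp
  also have "\<dots> = 1\<^sub>m n + (B + (A + A * B))"
    using carr by (intro assoc_add_mat[of _ n n]) auto
  finally show ?thesis
    using hess_nil_add_closed[OF AB(2) hess_nil_add_closed[OF AB(1) hess_nil_mult_closed[OF h AB(1,2)]]]
    by (auto simp: hess_unip_def)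
qed

section \<open>The general linear group and similarity\<close>

lemma carrier_GL: "carrier (GL TYPE('a :: {field, finite}) n) = {A \<in> carrier_mat n n. det A \<noteq> 0}"
proof -
  have "carrier (GL TYPE('a) n) = Units (ring_mat TYPE('a) n ())"
    by (simp add: GL_def units_of_carrier)
  also have "\<dots> = {A \<in> carrier_mat n n. det A \<noteq> 0}"
    using det_non_zero_imp_unit[where b = "()" and n = n and 'a = 'a]
      unit_imp_det_non_zero[where b = "()" and n = n and 'a = 'a]
    by (auto simp: Units_def ring_mat_simps)
  finally show ?thesis .
qed

lemma mult_GL: "mult (GL TYPE('a :: {field, finite}) n) = (*)"
  by (simp add: GL_def units_of_mult ring_mat_simps)

lemma one_GL: "one (GL TYPE('a :: {field, finite}) n) = 1\<^sub>m n"
  by (simp add: GL_def units_of_one ring_mat_simps)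

lemma group_GL: "group (GL TYPE('a :: {field, finite}) n)"
proof -
  interpret ring "ring_mat TYPE('a) n ()"
    by (rule ring_mat)
  show ?thesis
    unfolding GL_def by (rule units_group)
qed

lemma finite_GL: "finite (carrier (GL TYPE('a :: {field, finite}) n))"
  by (rule finite_subset[OF _ finite_carrier_mat[of n]]) (auto simp: carrier_GL)

lemma GL_inverse:
  fixes n
  defines "G \<equiv> GL TYPE('a :: {field, finite}) n"
  assumes g: "g \<in> carrier G"
  shows "inv\<^bsub>G\<^esub> g \<in> carrier_mat n n" "g * inv\<^bsub>G\<^esub> g = 1\<^sub>m n" "inv\<^bsub>G\<^esub> g * g = 1\<^sub>m n"
proof -
  interpret group G unfolding G_def by (rule group_GL)
  show "inv\<^bsub>G\<^esub> g \<in> carrier_mat n n"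
    using inv_closed[OF g] by (simp add: G_def carrier_GL)
  show "g * inv\<^bsub>G\<^esub> g = 1\<^sub>m n" "inv\<^bsub>G\<^esub> g * g = 1\<^sub>m n"
    using r_inv[OF g] l_inv[OF g] by (simp_all add: G_def mult_GL one_GL)
qed

text \<open>The matrix is upper triangular with ones on the diagonal, so its determinant is
  1.\<close>

lemma one_plus_strictly_upper_in_GL:
  assumes A: "A \<in> carrier_mat n n" and z: "\<And>i j. i < n \<Longrightarrow> j \<le> i \<Longrightarrow> A $$ (i, j) = (0 :: 'a :: {field, finite})"
  shows "1\<^sub>m n + A \<in> carrier (GL TYPE('a) n)"
proof -
  have "upper_triangular (1\<^sub>m n + A)"
    using A z by (auto simp: upper_triangular_def)
  then have "det (1\<^sub>m n + A) = prod_list (diag_mat (1\<^sub>m n + A))"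
    using A by (intro det_upper_triangular) auto
  also have "diag_mat (1\<^sub>m n + A) = replicate n 1"
    using A z by (auto simp: diag_mat_def intro!: nth_equalityI)
  finally show ?thesis
    using A by (simp add: carrier_GL)
qed

text \<open>Since h(i) >= i, the positions forced to vanish include the diagonal and everything
  below it.\<close>

lemma hess_nil_strictly_upper:
  assumes "hessenberg n h" "A \<in> hess_nil n h" "i < n" "j \<le> i"
  shows "A $$ (i, j) = 0"
proof -
  have "j < n" "Suc j \<le> h (Suc i)"
    using assms(3,4) hessenbergD(2)[OF assms(1,3)] by linarith+
  then show ?thesis
    using assms(2,3) by (simp add: hess_nil_iff)
qed

text \<open>Bridge from conjugation by group elements to \<open>similar_mat\<close>, the relation in
  which results on Jordan forms are phrased: a similarity witness (P, Q) consists of two units with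
  Q inverse to P.\<close>

lemma conj_class_iff_similar:
  fixes A B :: "'a :: {field, finite} mat"
  assumes B: "B \<in> carrier_mat n n"
  shows "A \<in> conj_class n B \<longleftrightarrow> A \<in> carrier_mat n n \<and> similar_mat A B"
proof
  assume "A \<in> conj_class n B"
  then obtain g where g: "g \<in> carrier (GL TYPE('a) n)" "A = g * B * inv\<^bsub>GL TYPE('a) n\<^esub> g"
    by (auto simp: conj_class_def)
  have "g \<in> carrier_mat n n"
    using g(1) by (simp add: carrier_GL)
  then show "A \<in> carrier_mat n n \<and> similar_mat A B"
    using GL_inverse[OF g(1)] B g(2)
    by (intro conjI similar_matI[where n = n and P = g and Q = "inv\<^bsub>GL TYPE('a) n\<^esub> g"]) auto
next
  assume A: "A \<in> carrier_mat n n \<and> similar_mat A B"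
  then obtain P Q where PQ: "similar_mat_wit A B P Q"
    by (auto simp: similar_mat_def)
  note D = similar_mat_witD2[OF conjunct1[OF A] PQ]
  interpret group "GL TYPE('a) n" by (rule group_GL)
  have PQ: "P \<in> carrier (GL TYPE('a) n)" "Q \<in> carrier (GL TYPE('a) n)"
    using D(1,2,6,7) by (auto simp: GL_def units_of_carrier Units_def ring_mat_simps)
  then have "Q = inv\<^bsub>GL TYPE('a) n\<^esub> P"
    using D(2) by (intro inv_equality[symmetric]) (auto simp: mult_GL one_GL)
  then show "A \<in> conj_class n B"
    using PQ D(3) by (auto simp: conj_class_def)
qed

section \<open>Nilpotent Jordan matrices and partitions\<close>

text \<open>Conjugation by a block permutation matrix; P and its inverse Q have different shapes
  because the two blocks may differ in size.\<close>

lemma similar_mat_swap_blocks: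
  fixes A B :: "'a :: comm_ring_1 mat"
  assumes A: "A \<in> carrier_mat n n" and B: "B \<in> carrier_mat m m"
  shows "similar_mat (four_block_mat A (0\<^sub>m n m) (0\<^sub>m m n) B)
    (four_block_mat B (0\<^sub>m m n) (0\<^sub>m n m) A)"
proof (rule similar_matI)
  let ?P = "four_block_mat (0\<^sub>m n m) (1\<^sub>m n) (1\<^sub>m m) (0\<^sub>m m n) :: 'a mat"
  let ?Q = "four_block_mat (0\<^sub>m m n) (1\<^sub>m m) (1\<^sub>m n) (0\<^sub>m n m) :: 'a mat"
  let ?D = "four_block_mat B (0\<^sub>m m n) (0\<^sub>m n m) A"
  show "{four_block_mat A (0\<^sub>m n m) (0\<^sub>m m n) B, ?D, ?P, ?Q} \<subseteq> carrier_mat (n + m) (n + m)"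
    using A B by (auto intro!: carrier_matI)
  show "?P * ?Q = 1\<^sub>m (n + m)"
    by (subst mult_four_block_mat[where ?nr1.0 = n and ?n1.0 = m and ?n2.0 = n and ?nr2.0 = m
        and ?nc1.0 = n and ?nc2.0 = m]) auto
  have "?Q * ?P = 1\<^sub>m (m + n)"
    by (subst mult_four_block_mat[where ?nr1.0 = m and ?n1.0 = n and ?n2.0 = m and ?nr2.0 = n
        and ?nc1.0 = m and ?nc2.0 = n]) auto
  then show "?Q * ?P = 1\<^sub>m (n + m)"
    by (simp add: add.commute)
  have "?P * ?D = four_block_mat (0\<^sub>m n m) A B (0\<^sub>m m n)"
    using A B by (subst mult_four_block_mat[where ?nr1.0 = n and ?n1.0 = m and ?n2.0 = n
        and ?nr2.0 = m and ?nc1.0 = m and ?nc2.0 = n]) auto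
  then show "four_block_mat A (0\<^sub>m n m) (0\<^sub>m m n) B = ?P * ?D * ?Q"
    using A B by (simp, subst mult_four_block_mat[where ?nr1.0 = n and ?n1.0 = m and ?n2.0 = n
        and ?nr2.0 = m and ?nc1.0 = n and ?nc2.0 = m]) auto
qed

lemma jordan_matrix_append:
  "jordan_matrix (xs @ ys) = four_block_mat (jordan_matrix xs)
     (0\<^sub>m (sum_list (map fst xs)) (sum_list (map fst ys)))
     (0\<^sub>m (sum_list (map fst ys)) (sum_list (map fst xs))) (jordan_matrix ys)"
  using jordan_matrix_dim[of xs] jordan_matrix_dim[of ys]
  by (simp add: jordan_matrix_def diag_block_mat_append Let_def)

text \<open>Induction on \<open>xs\<close>: split \<open>ys\<close> at an occurrence of x. The
  induction hypothesis rearranges the blocks after x into \<open>bs @ as\<close>, and one block swap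
  then moves \<open>as\<close> to the front.\<close>

lemma similar_mat_jordan_matrix_mset:
  fixes xs ys :: "(nat \<times> 'a :: comm_ring_1) list"
  shows "mset xs = mset ys \<Longrightarrow> similar_mat (jordan_matrix xs) (jordan_matrix ys)"
proof (induction xs arbitrary: ys)
  case Nil
  then show ?case
    by (auto intro: similar_mat_refl[OF jordan_matrix_carrier])
next
  case (Cons x xs)
  then obtain as bs where ys: "ys = as @ x # bs"
    by (metis list.set_intros(1) mset_eq_setD split_list)
  then have "similar_mat (jordan_matrix xs) (jordan_matrix (bs @ as))"
    using Cons by simp
  \<comment> \<open>Equal total sizes make the zero blocks of the two block matrices
    coincide.\<close>
  moreover have "sum_list (map fst xs) = sum_list (map fst (bs @ as))"
  proof -
    have "mset xs = mset (bs @ as)"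
      using Cons.prems ys by simp
    then show ?thesis
      by (metis mset_map sum_mset_sum_list)
  qed
  ultimately have "similar_mat (jordan_matrix ([x] @ xs)) (jordan_matrix ([x] @ (bs @ as)))"
    unfolding jordan_matrix_append[of "[x]"]
    by (metis jordan_matrix_carrier similar_mat_four_block_0_0 similar_mat_refl)
  moreover have "similar_mat (jordan_matrix ((x # bs) @ as)) (jordan_matrix (as @ (x # bs)))"
    unfolding jordan_matrix_append by (rule similar_mat_swap_blocks) auto
  ultimately show ?case
    unfolding ys by (auto intro: similar_mat_trans)
qed

lemma nilp_jordan_carrier: "nilp_jordan \<mu> \<in> carrier_mat (sum_list \<mu>) (sum_list \<mu>)"
  using jordan_matrix_carrier[of "map (\<lambda>m. (m, 0)) \<mu>"] by (simp add: nilp_jordan_def o_def)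

text \<open>Peels off the first block: a Jordan block for eigenvalue 0 has its ones on the
  superdiagonal. This serves to place I + J_\<mu> in the general linear group.\<close>

lemma nilp_jordan_strictly_upper:
  "i < sum_list \<mu> \<Longrightarrow> j \<le> i \<Longrightarrow> (nilp_jordan \<mu> :: 'a :: {field, finite} mat) $$ (i, j) = 0"
proof (induction \<mu> arbitrary: i j)
  case (Cons m \<mu>)
  have "nilp_jordan (m # \<mu>) = four_block_mat (jordan_block m (0 :: 'a)) (0\<^sub>m m (sum_list \<mu>))
      (0\<^sub>m (sum_list \<mu>) m) (nilp_jordan \<mu>)"
    by (simp add: nilp_jordan_def jordan_matrix_Cons o_def)
  moreover have "dim_row (nilp_jordan \<mu> :: 'a mat) = sum_list \<mu>"
      "dim_col (nilp_jordan \<mu> :: 'a mat) = sum_list \<mu>"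
    using nilp_jordan_carrier[of \<mu>, where 'a = 'a] by auto
  moreover have "(nilp_jordan \<mu> :: 'a mat) $$ (i - m, j - m) = 0" if "\<not> i < m" "\<not> j < m"
    using Cons that by (intro Cons.IH) auto
  moreover have "i < m + sum_list \<mu>" "j \<le> i"
    using Cons.prems by simp_all
  ultimately show ?case
    by simp
qed simp

text \<open>A triangular matrix has a Jordan form over any field. Here the characteristic polynomial
  is X^n, so every block has eigenvalue 0, and the block sizes in weakly decreasing order form the
  partition.\<close>

lemma strictly_upper_similar_nilp_jordan:
  fixes A :: "'a :: {field, finite} mat"
  assumes A: "A \<in> carrier_mat n n" and z: "\<And>i j. i < n \<Longrightarrow> j \<le> i \<Longrightarrow> A $$ (i, j) = 0"
  obtains \<mu> where "\<mu> \<in> partitions_of n" "similar_mat A (nilp_jordan \<mu>)"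
proof -
  have ut: "upper_triangular A"
    using A z by auto
  (* jordan_nf_exists needs a conjugatable ordered field; for a triangular matrix the algorithm
     triangular_to_jnf_vector is correct over every field. *)
  define xs where "xs = triangular_to_jnf_vector A"
  have jnf: "jordan_nf A xs"
    unfolding xs_def by (rule triangular_to_jnf_vector[OF A ut])
  have diag: "diag_mat A = replicate n 0"
    using A z by (auto simp: diag_mat_def intro!: nth_equalityI)
  have cp: "char_poly A = [:0, 1:] ^ n"
    unfolding char_poly_upper_triangular[OF A ut] diag by (simp add: prod_list_replicate)
  define ms where "ms = map fst xs"
  have pos: "0 \<notin> set ms"
    using jnf by (simp add: jordan_nf_def ms_def)
  \<comment> \<open>A block of size m at a makes a a root of X^n of multiplicity at least m >
    0.\<close>
  have "a = 0" if "(m, a) \<in> set xs" for m a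
  proof -
    have "m \<noteq> 0"
      using pos that by (force simp: ms_def)
    then have "Polynomial.order a (char_poly A) \<noteq> 0"
      using jordan_nf_block_size_order_bound[OF jnf that] by simp
    then have "poly (char_poly A) a = 0"
      by (simp add: order_root)
    then show ?thesis
      by (simp add: cp)
  qed
  then have xs: "xs = map (\<lambda>m. (m, 0)) ms"
    unfolding ms_def by (induction xs) auto
  \<comment> \<open>\<open>sort\<close> is ascending, whereas partitions list their parts in weakly
    decreasing order.\<close>
  define \<mu> where "\<mu> = rev (sort ms)"
  have ms_mu: "mset ms = mset \<mu>"
    by (simp add: \<mu>_def)
  have sim: "similar_mat A (nilp_jordan \<mu>)"
    using jnf similar_mat_jordan_matrix_mset[of xs "map (\<lambda>m. (m, 0)) \<mu>"] ms_mu
    unfolding xs jordan_nf_def nilp_jordan_def by (auto intro: similar_mat_trans)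
  \<comment> \<open>Similar matrices have equal dimension, and that of
    \<open>nilp_jordan \<mu>\<close> is the sum of the parts.\<close>
  have "sum_list \<mu> = n"
  proof -
    obtain k where "A \<in> carrier_mat k k" "(nilp_jordan \<mu> :: 'a mat) \<in> carrier_mat k k"
      using similar_matD[OF sim] by blast
    then show ?thesis
      using A nilp_jordan_carrier[of \<mu>, where 'a = 'a] by (metis carrier_matD(1))
  qed
  moreover have "sorted_wrt (\<ge>) \<mu>"
    by (simp add: \<mu>_def sorted_wrt_rev)
  moreover have "0 \<notin> set \<mu>"
    using pos by (simp add: \<mu>_def)
  ultimately have "\<mu> \<in> partitions_of n"
    unfolding partitions_of_def by (auto intro!: gr0I)
  then show thesis
    using sim that by blast
qed

text \<open>Both lists give Jordan normal forms of one matrix, and its number of blocks of each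
  positive size is determined by dimensions of generalized eigenspaces. So the parts agree with
  multiplicity, and sortedness fixes their order.\<close>

lemma similar_nilp_jordan_imp_eq:
  assumes \<mu>: "\<mu> \<in> partitions_of n" and \<nu>: "\<nu> \<in> partitions_of n"
    and sim: "similar_mat (nilp_jordan \<mu> :: 'a :: {field, finite} mat) (nilp_jordan \<nu>)"
  shows "\<mu> = \<nu>"
proof -
  let ?A = "nilp_jordan \<mu> :: 'a mat"
  let ?J = "\<lambda>\<mu>. map (\<lambda>m. (m, 0 :: 'a)) \<mu>"
  have pos: "0 \<notin> set \<mu>" "0 \<notin> set \<nu>"
    using \<mu> \<nu> by (auto simp: partitions_of_def)
  have jnf: "jordan_nf ?A (?J \<mu>)" "jordan_nf ?A (?J \<nu>)"
    using pos sim similar_mat_refl[OF nilp_jordan_carrier[of \<mu>, where 'a = 'a]]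
    by (auto simp: jordan_nf_def nilp_jordan_def)
  have len: "length (filter ((=) (k, 0)) (?J \<kappa>)) = count (mset \<kappa>) k" for k \<kappa>
    by (induction \<kappa>) auto
  have "count (mset \<mu>) k = count (mset \<nu>) k" for k
  \<comment> \<open>Blocks of size 0 leave no trace in the matrix; positivity of the parts settles
    this case.\<close>
  proof (cases "k = 0")
    case True
    have "count (mset \<mu>) 0 = 0" "count (mset \<nu>) 0 = 0"
      using pos by (simp_all add: count_eq_zero_iff)
    then show ?thesis
      by (simp only: True)
  next
    case False
    then show ?thesis
      using compute_nr_of_jordan_blocks[OF jnf(1) False, of 0]
        compute_nr_of_jordan_blocks[OF jnf(2) False, of 0] by (simp only: len)
  qed
  then have "mset (rev \<mu>) = mset (rev \<nu>)"
    by (simp add: multiset_eqI)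
  moreover have "sorted (rev \<mu>)" "sorted (rev \<nu>)"
    using \<mu> \<nu> by (simp_all add: partitions_of_def sorted_wrt_rev)
  ultimately show ?thesis
    by (metis properties_for_sort rev_rev_ident)
qed

text \<open>Every part is at most n, and since the parts are positive there are at most n of
  them.\<close>

lemma finite_partitions_of: "finite (partitions_of n)"
proof (rule finite_subset)
  have "length \<mu> \<le> sum_list \<mu>" if "\<forall>m\<in>set \<mu>. 0 < m" for \<mu> :: "nat list"
    using that by (induction \<mu>) auto
  then show "partitions_of n \<subseteq> {\<mu>. set \<mu> \<subseteq> {..n} \<and> length \<mu> \<le> n}"
    by (auto simp: partitions_of_def dest: member_le_sum_list)
  show "finite {\<mu>. set \<mu> \<subseteq> {..n} \<and> length \<mu> \<le> n}"
    by (rule finite_lists_length_le) simp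
qed

section \<open>From nilpotent to unipotent matrices\<close>

lemma inj_on_one_plus: "inj_on ((+) (1\<^sub>m n :: 'a :: ring_1 mat)) (carrier_mat n n)"
proof (rule inj_onI)
  fix A B :: "'a mat"
  assume AB: "A \<in> carrier_mat n n" "B \<in> carrier_mat n n" and eq: "1\<^sub>m n + A = 1\<^sub>m n + B"
  show "A = B"
  proof (rule eq_matI)
    fix i j assume "i < dim_row B" "j < dim_col B"
    then show "A $$ (i, j) = B $$ (i, j)"
      using AB arg_cong[OF eq, of "\<lambda>M. M $$ (i, j)"] by simp
  qed (use AB in auto)
qed

text \<open>Conjugation fixes the identity matrix: g (I + J) g^{-1} = I + g J g^{-1}.\<close>

lemma conj_by_one_plus:
  fixes J :: "'a :: {field, finite} mat"
  assumes J: "J \<in> carrier_mat n n"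
  shows "group.conj_by (GL TYPE('a) n) (1\<^sub>m n + J) = (+) (1\<^sub>m n) ` conj_class n J"
proof -
  let ?G = "GL TYPE('a) n"
  interpret group ?G by (rule group_GL)
  have "g * (1\<^sub>m n + J) * inv\<^bsub>?G\<^esub> g = 1\<^sub>m n + g * J * inv\<^bsub>?G\<^esub> g"
    if g: "g \<in> carrier ?G" for g
  proof -
    have g': "g \<in> carrier_mat n n"
      using g by (simp add: carrier_GL)
    have "g * (1\<^sub>m n + J) = g + g * J"
      using g' J by (simp add: mult_add_distrib_mat[OF g' one_carrier_mat J])
    then show ?thesis
      using g' J GL_inverse[OF g] by (simp add: add_mult_distrib_mat[of _ n n])
  qed
  then show ?thesis
    unfolding conj_by_def conj_class_def by (force simp: mult_GL)
qed

lemma hess_unip_eq_image: "hess_unip n h = (+) (1\<^sub>m n) ` hess_nil n h"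
  by (auto simp: hess_unip_def)

lemma hess_nil_subset: "hess_nil n h \<subseteq> carrier_mat n n"
  by (auto simp: hess_nil_iff)

lemma subgroup_hess_unip:
  assumes h: "hessenberg n h"
  shows "subgroup (hess_unip n h) (GL TYPE('a :: {field, finite}) n)"
proof -
  interpret group "GL TYPE('a) n" by (rule group_GL)
  have sub: "hess_unip n h \<subseteq> carrier (GL TYPE('a) n)"
    using hess_nil_strictly_upper[OF h] hess_nil_subset[of n h]
    by (auto simp: hess_unip_eq_image intro!: one_plus_strictly_upper_in_GL)
  show ?thesis
  proof (rule finite_subgroupI)
    show "finite (hess_unip n h :: 'a mat set)"
      using sub finite_GL by (rule finite_subset)
    have "0\<^sub>m n n \<in> hess_nil n h"
      by (simp add: hess_nil_iff)
    then show "hess_unip n h \<noteq> {}"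
      by (auto simp: hess_unip_eq_image)
  qed (use sub hess_unip_mult_closed[OF h] in \<open>auto simp: mult_GL\<close>)
qed

lemma card_hess_unip:
  "card (hess_unip n h :: 'a :: {field, finite} mat set) = card (hess_nil n h :: 'a mat set)"
  unfolding hess_unip_eq_image
  by (intro card_image inj_on_subset[OF inj_on_one_plus hess_nil_subset])

text \<open>The injective shift A -> I + A carries class to class and \<open>hess_nil\<close> to
  \<open>hess_unip\<close>, so it preserves the size of the intersection.\<close>

lemma card_conj_by_hess_unip:
  assumes \<mu>: "\<mu> \<in> partitions_of n"
  shows "card (group.conj_by (GL TYPE('a :: {field, finite}) n) (1\<^sub>m n + nilp_jordan \<mu>) \<inter> hess_unip n h)
    = hess_count TYPE('a) n \<mu> h"
proof -
  have J: "(nilp_jordan \<mu> :: 'a mat) \<in> carrier_mat n n"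
    using nilp_jordan_carrier[of \<mu>] \<mu> by (auto simp: partitions_of_def)
  have "conj_class n (nilp_jordan \<mu> :: 'a mat) \<subseteq> carrier_mat n n"
    using conj_class_iff_similar[OF J] by auto
  then have "(+) (1\<^sub>m n) ` conj_class n (nilp_jordan \<mu> :: 'a mat) \<inter> (+) (1\<^sub>m n) ` hess_nil n h =
      (+) (1\<^sub>m n) ` (conj_class n (nilp_jordan \<mu>) \<inter> hess_nil n h)"
    using inj_on_image_Int[OF inj_on_one_plus _ hess_nil_subset] by metis
  then show ?thesis
    unfolding conj_by_one_plus[OF J] hess_unip_eq_image hess_count_def
    using hess_nil_subset by (auto intro!: card_image inj_on_subset[OF inj_on_one_plus])
qed

section \<open>Counting double cosets of the unipotent subgroups\<close>

theorem theorem2p11: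
  fixes n :: nat and h1 h2 :: "nat \<Rightarrow> nat"
  defines "G \<equiv> GL TYPE('a :: {field, finite}) n" and "q \<equiv> CARD('a)"
  assumes "hessenberg n h1" and "hessenberg n h2"
  shows "real (card (double_cosets G (hess_unip n h1) (hess_unip n h2))) =
    real q powi (int (hess_size n h1) + int (hess_size n h2) - 2 * int n ^ 2) *
    (\<Sum>\<mu>\<in>partitions_of n.
       real (card (centralizer G (1\<^sub>m n + nilp_jordan \<mu>))) *
       real (hess_count TYPE('a) n \<mu> h1) * real (hess_count TYPE('a) n \<mu> h2))"
proof -
  interpret group G
    unfolding G_def by (rule group_GL)
  let ?J = "\<lambda>\<mu>. nilp_jordan \<mu> :: 'a mat"
  have J: "?J \<mu> \<in> carrier_mat n n" if "\<mu> \<in> partitions_of n" for \<mu>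
    using nilp_jordan_carrier[of \<mu>] that by (auto simp: partitions_of_def)
  \<comment> \<open>Class membership is read as similarity of the nilpotent parts, so that existence
    and uniqueness of the Jordan type supply the hypotheses on class representatives below.\<close>
  have conj: "1\<^sub>m n + A \<in> conj_by (1\<^sub>m n + ?J \<mu>) \<longleftrightarrow> similar_mat A (?J \<mu>)"
    if "\<mu> \<in> partitions_of n" "A \<in> carrier_mat n n" for \<mu> A
    using that conj_class_iff_similar[OF J[OF that(1)]]
      inj_on_image_mem_iff[OF inj_on_one_plus that(2), of "conj_class n (?J \<mu>)"]
    unfolding G_def conj_by_one_plus[OF J[OF that(1)]] by blast
  have eq: "card (double_cosets G (hess_unip n h1) (hess_unip n h2)) *
      (card (hess_unip n h1 :: 'a mat set) * card (hess_unip n h2 :: 'a mat set)) =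
    (\<Sum>\<mu>\<in>partitions_of n. card (centralizer G (1\<^sub>m n + ?J \<mu>)) *
      card (conj_by (1\<^sub>m n + ?J \<mu>) \<inter> hess_unip n h1) * card (conj_by (1\<^sub>m n + ?J \<mu>) \<inter> hess_unip n h2))"
  proof (rule card_double_cosets_conj_classes)
    show "finite (carrier G)"
      unfolding G_def by (rule finite_GL)
    show "subgroup (hess_unip n h1) G" "subgroup (hess_unip n h2) G"
      unfolding G_def using assms by (auto intro: subgroup_hess_unip)
    show "finite (partitions_of n)"
      by (rule finite_partitions_of)
    show r: "1\<^sub>m n + ?J \<mu> \<in> carrier G" if "\<mu> \<in> partitions_of n" for \<mu>
      unfolding G_def using J[OF that] that
      by (auto simp: partitions_of_def intro!: one_plus_strictly_upper_in_GL nilp_jordan_strictly_upper)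
    show "\<exists>\<mu>\<in>partitions_of n. X \<in> conj_by (1\<^sub>m n + ?J \<mu>)" if "X \<in> hess_unip n h1" for X
    proof -
      obtain A where A: "A \<in> hess_nil n h1" "X = 1\<^sub>m n + A"
        using \<open>X \<in> hess_unip n h1\<close> by (auto simp: hess_unip_def)
      then have carr: "A \<in> carrier_mat n n"
        using hess_nil_subset by blast
      obtain \<mu> where "\<mu> \<in> partitions_of n" "similar_mat A (?J \<mu>)"
        using strictly_upper_similar_nilp_jordan[OF carr hess_nil_strictly_upper[OF assms(3) A(1)]] .
      then show ?thesis
        using conj carr A(2) by blast
    qed
    show "\<mu> = \<nu>"
      if \<mu>: "\<mu> \<in> partitions_of n" and \<nu>: "\<nu> \<in> partitions_of n"
        and X: "X \<in> conj_by (1\<^sub>m n + ?J \<mu>)" "X \<in> conj_by (1\<^sub>m n + ?J \<nu>)" for X \<mu> \<nu>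
    proof -
      obtain A where A: "A \<in> conj_class n (?J \<mu>)" "X = 1\<^sub>m n + A"
        using X(1) unfolding G_def conj_by_one_plus[OF J[OF \<mu>]] by blast
      then have carr: "A \<in> carrier_mat n n"
        using conj_class_iff_similar[OF J[OF \<mu>]] by blast
      \<comment> \<open>Through A, the two Jordan matrices are similar to each other.\<close>
      have "similar_mat A (?J \<mu>)" "similar_mat A (?J \<nu>)"
        using X conj[OF \<mu> carr] conj[OF \<nu> carr] A(2) by auto
      then show ?thesis
        using similar_nilp_jordan_imp_eq[OF \<mu> \<nu>] by (blast intro: similar_mat_trans similar_mat_sym)
    qed
  qed
  define D where "D = card (double_cosets G (hess_unip n h1) (hess_unip n h2))"
  define c where "c h = card (hess_nil n h :: 'a mat set)" for h
  define S where "S = (\<Sum>\<mu>\<in>partitions_of n. card (centralizer G (1\<^sub>m n + ?J \<mu>)) *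
    hess_count TYPE('a) n \<mu> h1 * hess_count TYPE('a) n \<mu> h2)"
  have "D * (c h1 * c h2) = S"
    using eq unfolding D_def S_def c_def card_hess_unip G_def by (simp add: card_conj_by_hess_unip)
  \<comment> \<open>Multiplying by the two powers of q turns \<open>c h1\<close> and
    \<open>c h2\<close> into q^{n^2} each, so the identity stays in the natural numbers and no
    division occurs before the passage to reals.\<close>
  moreover have "c h1 * q ^ hess_size n h1 = q ^ n\<^sup>2" "c h2 * q ^ hess_size n h2 = q ^ n\<^sup>2"
    using card_hess_nil assms(3,4) by (auto simp: c_def q_def)
  then have "q ^ n\<^sup>2 * q ^ n\<^sup>2 = (c h1 * c h2) * (q ^ hess_size n h1 * q ^ hess_size n h2)"
    by (metis mult.assoc mult.left_commute)
  ultimately have "D * (q ^ n\<^sup>2 * q ^ n\<^sup>2) = S * (q ^ hess_size n h1 * q ^ hess_size n h2)"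
    by (simp only: mult.assoc[symmetric])
  from arg_cong[OF this, of real] have "real D * (real q ^ n\<^sup>2 * real q ^ n\<^sup>2) =
      real S * (real q ^ hess_size n h1 * real q ^ hess_size n h2)"
    by (simp only: of_nat_mult of_nat_power)
  moreover have q: "real q \<noteq> 0"
    by (simp add: q_def)
  ultimately have "real D = real q ^ hess_size n h1 * real q ^ hess_size n h2 /
      (real q ^ n\<^sup>2 * real q ^ n\<^sup>2) * real S"
    by (simp add: nonzero_eq_divide_eq mult.commute)
  \<comment> \<open>Since |h| <= n^2 for both functions, the exponent |h1| + |h2| - 2 n^2 is never
    positive; an integer power expresses the quotient as a single factor.\<close>
  also have "real q ^ hess_size n h1 * real q ^ hess_size n h2 / (real q ^ n\<^sup>2 * real q ^ n\<^sup>2) =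
      real q powi (int (hess_size n h1 + hess_size n h2) - int (n\<^sup>2 + n\<^sup>2))"
    by (simp only: power_int_diff[OF disjI1[OF q]] power_int_of_nat power_add)
  also have "int (hess_size n h1 + hess_size n h2) - int (n\<^sup>2 + n\<^sup>2) =
      int (hess_size n h1) + int (hess_size n h2) - 2 * int n ^ 2"
    by simp
  finally show ?thesis
    unfolding D_def S_def by simp
qed

end
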